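(* For the finite-horizon linear system with linear Gaussian policy described in the context, if $Q_a\succ0$, then $\nabla_\ell J=0$ if and only if $\Sigma=\mathbf 0$.
   Context: $n,m,T\ge1$, $A\in\mathbb R^{n\times n}$, $B\in\mathbb R^{n\times m}$, $K\in\mathbb R^{m\times n}$, $F:=A+BK$; $Q_s\in\mathbb R^{n\times n}$, $Q_a\in\mathbb R^{m\times m}$ symmetric positive semidefinite; discount factor $\gamma\in(0,1]$. $s_0\sim\mathcal N(0,\Sigma_0)$ with $\Sigma_0\succeq0$ and $\varepsilon_t\sim\mathcal N(0,\Sigma)$ are independent; $a_t=Ks_t+\varepsilon_t$, $s_{t+1}=As_t+Ba_t$; $J(K,\Sigma)=\mathbb E\big[\sum_{t=0}^{T-1}\gamma^tr(s_{t+1},a_t)\big]$ with $r(s,a)=-(s^\top Q_ss+a^\top Q_aa)$. The covariance $\Sigma$ is diagonal, $\Sigma=\mathrm{diag}(\sigma_1^2,\dots,\sigma_m^2)$, parameterized by $\ell_i=\log\sigma_i$. The gradient with respect to $\ell$ is $$\nabla_\ell J=-2\,\mathrm{diag}\Big(\Sigma\sum_{t=0}^{T-1}\gamma^t\big(Q_a+\gamma B^\top\Lambda_{t+1}B\big)\Big)\in\mathbb R^m,$$ where $\mathrm{diag}(M)$ of a matrix is the vector of its diagonal entries, $\Lambda_T=\tfrac1\gamma Q_s$ and $\Lambda_t=\tfrac1\gamma Q_s+K^\top Q_aK+\gamma F^\top\Lambda_{t+1}F$ for $1\le t\le T-1$. In the statement, $\nabla_\ell J$ is understood through this formula for every diagonal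 $\Sigma\succeq0$, including the singular limit in which some or all $\sigma_i=0$ ($\ell_i=-\infty$). *)

theory Defs
  imports "HOL-Analysis.Analysis"
begin

definition pos_semidef :: "real^'n^'n \<Rightarrow> bool" where
  "pos_semidef M \<longleftrightarrow> transpose M = M \<and> (\<forall>x. 0 \<le> x \<bullet> (M *v x))"

definition pos_def :: "real^'n^'n \<Rightarrow> bool" where
  "pos_def M \<longleftrightarrow> transpose M = M \<and> (\<forall>x. x \<noteq> 0 \<longrightarrow> 0 < x \<bullet> (M *v x))"

definition diag_of :: "real^'n^'n \<Rightarrow> real^'n" where
  "diag_of M = (\<chi> i. M $ i $ i)"

definition diag_mat :: "real^'n \<Rightarrow> real^'n^'n" where
  "diag_mat v = (\<chi> i j. if i = j then v $ i else 0)"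

(* The backward recursion for the matrices Lambda_t, indexed by the number k = T - t
   of remaining steps; Lam_terminal and Lam_step below give it in terms of t. *)
primrec Lam_to_go :: "real^'n^'n \<Rightarrow> real^'m^'n \<Rightarrow> real^'n^'m \<Rightarrow> real^'n^'n \<Rightarrow> real^'m^'m
    \<Rightarrow> real \<Rightarrow> nat \<Rightarrow> real^'n^'n" where
  "Lam_to_go A B K Qs Qa \<gamma> 0 = (1 / \<gamma>) *\<^sub>R Qs"
| "Lam_to_go A B K Qs Qa \<gamma> (Suc k) =
     (1 / \<gamma>) *\<^sub>R Qs + transpose K ** Qa ** K
     + \<gamma> *\<^sub>R (transpose (A + B ** K) ** Lam_to_go A B K Qs Qa \<gamma> k ** (A + B ** K))"

definition Lam :: "real^'n^'n \<Rightarrow> real^'m^'n \<Rightarrow> real^'n^'m \<Rightarrow> real^'n^'n \<Rightarrow> real^'m^'m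
    \<Rightarrow> real \<Rightarrow> nat \<Rightarrow> nat \<Rightarrow> real^'n^'n" where
  "Lam A B K Qs Qa \<gamma> T t = Lam_to_go A B K Qs Qa \<gamma> (T - t)"

lemma Lam_terminal: "Lam A B K Qs Qa \<gamma> T T = (1 / \<gamma>) *\<^sub>R Qs"
  by (simp add: Lam_def)

lemma Lam_step:
  assumes "t < T"
  shows "Lam A B K Qs Qa \<gamma> T t =
     (1 / \<gamma>) *\<^sub>R Qs + transpose K ** Qa ** K
     + \<gamma> *\<^sub>R (transpose (A + B ** K) ** Lam A B K Qs Qa \<gamma> T (t + 1) ** (A + B ** K))"
  using assms by (simp add: Lam_def Suc_diff_Suc flip: Lam_to_go.simps(2))

(* The gradient of the expected discounted return J(K, Sigma) with respect to the
   log-standard-deviations l_i = ln sigma_i, where Sigma = diag(sigma_1^2, ..., sigma_m^2),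
   given by its closed form.  The closed form, unlike the derivative in l, also makes
   sense in the singular limit sigma_i = 0, i.e. l_i = -infinity; it does not involve
   the covariance of the initial state. *)
definition grad_log_std :: "real^'n^'n \<Rightarrow> real^'m^'n \<Rightarrow> real^'n^'m \<Rightarrow> real^'n^'n \<Rightarrow> real^'m^'m
    \<Rightarrow> real \<Rightarrow> nat \<Rightarrow> real^'m^'m \<Rightarrow> real^'m" where
  "grad_log_std A B K Qs Qa \<gamma> T \<Sigma> =
     (-2) *\<^sub>R diag_of (\<Sigma> ** (\<Sum>t<T. \<gamma> ^ t *\<^sub>R
        (Qa + \<gamma> *\<^sub>R (transpose B ** Lam A B K Qs Qa \<gamma> T (t + 1) ** B))))"

end

theory Submission
  imports Defs
begin

text \<open>
  Since \<open>\<Sigma>\<close> is diagonal, the \<open>i\<close>-th entry of the gradient is \<open>- 2 \<sigma>\<^sub>i\<^sup>2 S\<^sub>i\<^sub>i\<close>, where \<open>S\<close> is the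
  discounted sum of the matrices \<open>Q\<^sub>a + \<gamma> B\<^sup>T \<Lambda>\<^sub>t\<^sub>+\<^sub>1 B\<close>. Each \<open>\<Lambda>\<^sub>t\<close> has a nonnegative quadratic form, so
  \<open>S\<close> inherits positive definiteness from \<open>Q\<^sub>a\<close>. Hence \<open>S\<^sub>i\<^sub>i > 0\<close>, and the \<open>i\<close>-th entry vanishes iff
  \<open>\<sigma>\<^sub>i = 0\<close>.
\<close>

text \<open>Serves the terms \<open>transpose K ** Qa ** K\<close> and
  \<open>transpose F ** \<Lambda> ** F\<close> with \<open>F = A + B ** K\<close>, and later
  \<open>transpose B ** \<Lambda> ** B\<close>.\<close>

lemma inner_congruence:
  fixes P :: "real^'n^'m" and M :: "real^'m^'m"
  shows "x \<bullet> ((transpose P ** M ** P) *v x) = (P *v x) \<bullet> (M *v (P *v x))"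
  by (metis dot_lmul_matrix matrix_vector_mul_assoc vector_transpose_matrix)

lemma matrix_vector_mult_sum_left:
  fixes M :: "'b \<Rightarrow> real^'n^'m"
  shows "sum M I *v x = (\<Sum>t\<in>I. M t *v x)"
  by (induction I rule: infinite_finite_induct)
    (simp_all add: matrix_vector_mult_add_rdistrib)

lemma inner_axis_matrix_axis:
  fixes M :: "real^'n^'n"
  shows "axis i 1 \<bullet> (M *v axis i 1) = M $ i $ i"
  by (simp add: inner_axis' matrix_vector_mul_component inner_axis)

lemma diag_of_diag_mat_mult:
  "diag_of (diag_mat v ** M) $ i = v $ i * M $ i $ i"
  by (simp add: diag_of_def diag_mat_def matrix_matrix_mult_def if_distrib[of "\<lambda>c. c * _"]
      cong: if_cong)

lemma diag_mat_eq_0_iff: "diag_mat v = 0 \<longleftrightarrow> v = 0"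
  by (auto simp: diag_mat_def vec_eq_iff)

lemma Lam_to_go_form_nonneg:
  assumes "0 < \<gamma>" "pos_semidef Qs" "pos_semidef Qa"
  shows "0 \<le> x \<bullet> (Lam_to_go A B K Qs Qa \<gamma> k *v x)"
\<comment> \<open>\<open>x\<close> is generalized because the induction hypothesis is used at
  \<open>(A + B ** K) *v x\<close>.\<close>
proof (induction k arbitrary: x)
  case 0
  then show ?case
    using assms by (simp add: pos_semidef_def flip: scaleR_matrix_vector_assoc)
next
  case (Suc k)
  then show ?case
    using assms
    by (simp add: pos_semidef_def matrix_vector_mult_add_rdistrib inner_add_right inner_congruence
        flip: scaleR_matrix_vector_assoc)
qed

theorem corollary7:
  fixes A :: "real^'n^'n" and B :: "real^'m^'n" and K :: "real^'n^'m"
    and Qs :: "real^'n^'n" and Qa :: "real^'m^'m"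
    and \<gamma> :: real and T :: nat
    and \<sigma> :: "real^'m" and \<Sigma> :: "real^'m^'m"
  assumes "T \<ge> 1"
    and "0 < \<gamma>" and "\<gamma> \<le> 1"
    and "pos_semidef Qs" and "pos_semidef Qa"
    and "\<forall>i. 0 \<le> \<sigma> $ i" and "\<Sigma> = diag_mat (\<chi> i. (\<sigma> $ i)\<^sup>2)"
    and "pos_def Qa"
  shows "grad_log_std A B K Qs Qa \<gamma> T \<Sigma> = 0 \<longleftrightarrow> \<Sigma> = 0"
proof -
  define S where "S = (\<Sum>t<T. \<gamma> ^ t *\<^sub>R
        (Qa + \<gamma> *\<^sub>R (transpose B ** Lam A B K Qs Qa \<gamma> T (t + 1) ** B)))"
  have "0 < x \<bullet> (S *v x)" if "x \<noteq> 0" for x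
  proof -
    have "0 < x \<bullet> (Qa *v x)
        + \<gamma> * ((B *v x) \<bullet> (Lam A B K Qs Qa \<gamma> T (t + 1) *v (B *v x)))" for t
      using assms that by (simp add: pos_def_def Lam_def Lam_to_go_form_nonneg add_pos_nonneg)
    moreover have "x \<bullet> (S *v x) = (\<Sum>t<T. \<gamma> ^ t * (x \<bullet> (Qa *v x)
        + \<gamma> * ((B *v x) \<bullet> (Lam A B K Qs Qa \<gamma> T (t + 1) *v (B *v x)))))"
      unfolding S_def
      by (simp add: matrix_vector_mult_sum_left inner_sum_right matrix_vector_mult_add_rdistrib
          inner_add_right inner_congruence flip: scaleR_matrix_vector_assoc)
    ultimately show ?thesis
      \<comment> \<open>\<open>T \<ge> 1\<close> makes the sum nonempty, so positive summands give a
        strictly positive total.\<close>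
      using assms(1,2) by (auto simp: lessThan_empty_iff intro!: sum_pos)
  qed
  \<comment> \<open>Take \<open>x = axis i 1\<close> in the quadratic form.\<close>
  then have "0 < S $ i $ i" for i
    using inner_axis_matrix_axis[of i S] by (metis axis_eq_0_iff zero_neq_one)
  then have "S $ i $ i \<noteq> 0" for i
    by (metis less_irrefl)
  moreover have "grad_log_std A B K Qs Qa \<gamma> T \<Sigma> $ i = - 2 * ((\<sigma> $ i)\<^sup>2 * S $ i $ i)" for i
    unfolding grad_log_std_def S_def[symmetric] assms(7) by (simp add: diag_of_diag_mat_mult)
  ultimately show ?thesis
    unfolding assms(7) diag_mat_eq_0_iff by (simp add: vec_eq_iff)
qed

end
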